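(* Let $T=\{1243,2341,3412\}$ and let $F_T(x)=\sum_{n\ge0}|S_n(T)|x^n$. Then $$F_T(x)=\frac{1}{1-3x+x^2}+\frac{1}{1-x}+\frac{1-x+x^2}{(1-x)^4}-\frac{2(1-x)(1-2x-x^2)}{(1-2x)^3}.$$
   Context: $S_n$ is the set of permutations of $[n]$ ($S_0$ contains the empty permutation). A permutation avoids a pattern $\tau$ if it has no subsequence order-isomorphic to $\tau$; $S_n(T)$ is the set of permutations in $S_n$ avoiding every pattern in $T$. *)

theory Defs
  imports
    "HOL-Combinatorics.Multiset_Permutations"
    "HOL-Library.Sublist"
    "HOL-Computational_Algebra.Formal_Power_Series"
begin

(* Permutations of [n] are written in one-line notation, i.e. they are the elements of
   permutations_of_set {1..n} (the distinct lists whose set of entries is {1..n}).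
   Subsequences (subseq) need not be contiguous. *)

definition order_isomorphic :: "nat list \<Rightarrow> nat list \<Rightarrow> bool" where
  "order_isomorphic us vs \<longleftrightarrow>
     length us = length vs \<and>
     (\<forall>i < length us. \<forall>j < length us. us ! i < us ! j \<longleftrightarrow> vs ! i < vs ! j)"

definition avoids :: "nat list \<Rightarrow> nat list \<Rightarrow> bool" where
  "avoids p \<tau> \<longleftrightarrow> \<not> (\<exists>us. subseq us p \<and> order_isomorphic us \<tau>)"

definition avoiders :: "nat list set \<Rightarrow> nat \<Rightarrow> nat list set" where
  "avoiders T n = {p \<in> permutations_of_set {1..n}. \<forall>\<tau>\<in>T. avoids p \<tau>}"

definition avoiders_fps :: "nat list set \<Rightarrow> rat fps" where
  "avoiders_fps T = Abs_fps (\<lambda>n. of_nat (card (avoiders T n)))"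

end

(* Delete the entries 1, 2, ... of a permutation one after another. Reversing this, every
   avoider of length n + 1 arises uniquely from an avoider p of length n by inserting a new
   minimum at one of the active sites of p. The active sites after an insertion depend only on
   the previous active sites and on which windows of p contain an ascent, respectively which
   suffixes contain a descent. This information takes few shapes (the states P, Z, A, A', B, C, D
   below), each of which is determined up to its number of descendants by one integer:
     P_k -> P_1, ..., P_k            Z  -> P_1, Z             A' -> A_0, A', Z
     A_j -> P_2, ..., P_(j+1), A_0, A_j
     B_j -> P_3, ..., P_(j+2), B_j, A', A_0
     C_j -> B_0, ..., B_(j-1), C_j, C_(j+1), A_(j+1)
     D_j -> B_0, ..., B_(j-1), C_j, D_(j+1)
   The generating functions of the states are explicit combinations of powers of 1/(1-x), which
   is checked against these succession rules coefficient by coefficient. *)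
theory Submission
  imports Defs
begin

section \<open>Patterns and insertion of a new minimum\<close>

lemma subseq_Cons_iff:
  "subseq (a # us) p \<longleftrightarrow> (\<exists>i<length p. p ! i = a \<and> subseq us (drop (Suc i) p))"
proof
  assume "subseq (a # us) p"
  then obtain xs ys where "p = xs @ a # ys" "subseq us ys"
    by (auto dest!: list_emb_ConsD)
  then show "\<exists>i<length p. p ! i = a \<and> subseq us (drop (Suc i) p)"
    by (intro exI[of _ "length xs"]) auto
next
  assume "\<exists>i<length p. p ! i = a \<and> subseq us (drop (Suc i) p)"
  then obtain i where i: "i < length p" "p ! i = a" "subseq us (drop (Suc i) p)" by blast
  then have "subseq (a # us) (a # drop (Suc i) p)" by simp
  moreover have "p = take i p @ a # drop (Suc i) p" using i by (metis id_take_nth_drop)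
  ultimately show "subseq (a # us) p" by (metis list_emb_append2)
qed

text \<open>Positions are quantified instead of sublists, so that inserting an entry acts on each of
  the four quantifiers separately; \<open>R\<close> stays open to treat the three patterns
  alike.\<close>

definition occurs :: "nat list \<Rightarrow> (nat \<Rightarrow> nat \<Rightarrow> nat \<Rightarrow> nat \<Rightarrow> bool) \<Rightarrow> bool" where
  "occurs p R \<longleftrightarrow> (\<exists>i<length p. \<exists>j<length p. \<exists>k<length p. \<exists>l<length p.
     i < j \<and> j < k \<and> k < l \<and> R (p ! i) (p ! j) (p ! k) (p ! l))"

lemma subseq_drop_Cons_iff:
  assumes "d \<le> length p"
  shows "subseq (a # us) (drop d p) \<longleftrightarrow> (\<exists>i<length p. d \<le> i \<and> p ! i = a \<and> subseq us (drop (Suc i) p))"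
proof -
  have "(\<exists>i<length (drop d p). Q i) = (\<exists>i<length p. d \<le> i \<and> Q (i - d))" for Q
  proof (intro iffI; elim exE conjE)
    fix i assume "i < length (drop d p)" "Q i"
    then show "\<exists>i<length p. d \<le> i \<and> Q (i - d)" by (intro exI[of _ "i + d"]) auto
  next
    fix i assume "i < length p" "d \<le> i" "Q (i - d)"
    then show "\<exists>i<length (drop d p). Q i" by (intro exI[of _ "i - d"]) auto
  qed
  then show ?thesis
    unfolding subseq_Cons_iff using assms by (auto simp: add.commute)
qed

lemma subseq4_iff:
  "subseq [a, b, c, d] p \<longleftrightarrow> occurs p (\<lambda>a' b' c' d'. a' = a \<and> b' = b \<and> c' = c \<and> d' = d)"
proof -
  have "subseq [a, b, c, d] p \<longleftrightarrow> subseq [a, b, c, d] (drop 0 p)" by simp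
  also have "\<dots> \<longleftrightarrow> occurs p (\<lambda>a' b' c' d'. a' = a \<and> b' = b \<and> c' = c \<and> d' = d)"
    unfolding occurs_def by (simp add: subseq_drop_Cons_iff Suc_le_eq del: drop0 cong: conj_cong) blast
  finally show ?thesis .
qed

lemma avoids4_iff:
  "avoids p [t1, t2, t3, t4] \<longleftrightarrow> \<not> occurs p (\<lambda>a b c d. order_isomorphic [a, b, c, d] [t1, t2, t3, t4])"
proof -
  have *: "\<exists>a b c d. us = [a, b, c, d]" if "order_isomorphic us [t1, t2, t3, t4]" for us
    using that by (simp add: order_isomorphic_def length_Suc_conv) blast
  have "(\<exists>us. subseq us p \<and> order_isomorphic us [t1, t2, t3, t4]) \<longleftrightarrow>
        (\<exists>a b c d. subseq [a, b, c, d] p \<and> order_isomorphic [a, b, c, d] [t1, t2, t3, t4])" (is "?l \<longleftrightarrow> ?m")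
  proof
    assume ?l
    then obtain us where us: "subseq us p" "order_isomorphic us [t1, t2, t3, t4]" by blast
    then obtain a b c d where "us = [a, b, c, d]" using * by blast
    then show ?m using us by blast
  qed blast
  also have "\<dots> \<longleftrightarrow> occurs p (\<lambda>a b c d. order_isomorphic [a, b, c, d] [t1, t2, t3, t4])" (is "_ \<longleftrightarrow> ?r")
  proof
    assume ?r
    then obtain i j k l where "i < length p" "j < length p" "k < length p" "l < length p"
      "i < j" "j < k" "k < l" and
      oi: "order_isomorphic [p ! i, p ! j, p ! k, p ! l] [t1, t2, t3, t4]"
      unfolding occurs_def by blast
    then have "subseq [p ! i, p ! j, p ! k, p ! l] p"
      unfolding subseq4_iff occurs_def by blast
    then show ?m using oi by blast
  next
    assume ?m
    then obtain a b c d where oi: "order_isomorphic [a, b, c, d] [t1, t2, t3, t4]"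
      and "subseq [a, b, c, d] p" by blast
    then show ?r unfolding subseq4_iff occurs_def by (elim exE conjE) blast
  qed
  finally show ?thesis unfolding avoids_def by simp
qed

text \<open>The entries of a pattern are distinct, so comparing values that are consecutive in size
  forces all other comparisons.\<close>

lemma order_isomorphic4_iff:
  "order_isomorphic [a, b, c, d] [1, 2, 4, 3] \<longleftrightarrow> a < b \<and> b < d \<and> d < c"
  "order_isomorphic [a, b, c, d] [2, 3, 4, 1] \<longleftrightarrow> d < a \<and> a < b \<and> b < c"
  "order_isomorphic [a, b, c, d] [3, 4, 1, 2] \<longleftrightarrow> c < d \<and> d < a \<and> a < b"
proof -
  have *: "(\<forall>i<Suc (Suc (Suc (Suc 0))). P i) \<longleftrightarrow> P 0 \<and> P (Suc 0) \<and> P (Suc (Suc 0)) \<and> P (Suc (Suc (Suc 0)))"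
    for P :: "nat \<Rightarrow> bool"
    by (auto simp: less_Suc_eq)
  show "order_isomorphic [a, b, c, d] [1, 2, 4, 3] \<longleftrightarrow> a < b \<and> b < d \<and> d < c"
    unfolding order_isomorphic_def by (simp add: *) linarith
  show "order_isomorphic [a, b, c, d] [2, 3, 4, 1] \<longleftrightarrow> d < a \<and> a < b \<and> b < c"
    unfolding order_isomorphic_def by (simp add: *) linarith
  show "order_isomorphic [a, b, c, d] [3, 4, 1, 2] \<longleftrightarrow> c < d \<and> d < a \<and> a < b"
    unfolding order_isomorphic_def by (simp add: *) linarith
qed

definition good :: "nat list \<Rightarrow> bool" where
  "good p \<longleftrightarrow> \<not> occurs p (\<lambda>a b c d. a < b \<and> b < d \<and> d < c)
     \<and> \<not> occurs p (\<lambda>a b c d. d < a \<and> a < b \<and> b < c)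
     \<and> \<not> occurs p (\<lambda>a b c d. c < d \<and> d < a \<and> a < b)"

lemma avoiders_eq:
  "avoiders {[1,2,4,3], [2,3,4,1], [3,4,1,2]} n = {p \<in> permutations_of_set {1..n}. good p}"
  unfolding avoiders_def good_def by (simp only: avoids4_iff order_isomorphic4_iff ball_simps simp_thms)

section \<open>Inserting a new minimum\<close>

definition ins :: "nat \<Rightarrow> nat list \<Rightarrow> nat list" where
  "ins s p = map Suc (take s p) @ 1 # map Suc (drop s p)"

text \<open>Carries the index of an entry of \<open>p\<close> to its index in
  \<open>ins s p\<close>; only \<open>s\<close>, the index of the new minimum, is missed.\<close>

definition shift :: "nat \<Rightarrow> nat \<Rightarrow> nat" where
  "shift s i = (if i < s then i else Suc i)"

lemma length_ins [simp]: "length (ins s p) = Suc (length p)"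
  by (simp add: ins_def)

lemma nth_ins_shift [simp]: "s \<le> length p \<Longrightarrow> i < length p \<Longrightarrow> ins s p ! shift s i = Suc (p ! i)"
  by (auto simp: ins_def shift_def nth_append min_def)

lemma nth_ins_self [simp]: "s \<le> length p \<Longrightarrow> ins s p ! s = 1"
  by (auto simp: ins_def nth_append min_def)

lemma shift_simps [simp]:
  "shift s i < shift s j \<longleftrightarrow> i < j"
  "s < shift s i \<longleftrightarrow> s \<le> i"
  "shift s i < s \<longleftrightarrow> i < s"
  by (auto simp: shift_def)

lemma shift_less_Suc: "i < n \<Longrightarrow> shift s i < Suc n"
  by (auto simp: shift_def)

text \<open>Used as a rewrite rule that splits a quantifier over the positions of
  \<open>ins s p\<close> into the new minimum and the old entries.\<close>

lemma ex_ins_iff: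
  assumes "s \<le> n"
  shows "(\<exists>i<Suc n. P i) \<longleftrightarrow> P s \<or> (\<exists>i<n. P (shift s i))"
proof
  assume "\<exists>i<Suc n. P i"
  then obtain i where i: "i < Suc n" "P i" by blast
  consider "i < s" | "i = s" | j where "i = Suc j" "s \<le> j" by (cases i) fastforce+
  then show "P s \<or> (\<exists>i<n. P (shift s i))"
  proof cases
    case 1
    then have "shift s i = i" "i < n" using assms by (auto simp: shift_def)
    then show ?thesis using i by metis
  next
    case 2
    then show ?thesis using i by simp
  next
    case 3
    then have "shift s j = i" "j < n" using i by (auto simp: shift_def)
    then show ?thesis using i by metis
  qed
next
  assume "P s \<or> (\<exists>i<n. P (shift s i))"
  then show "\<exists>i<Suc n. P i"
    using assms le_imp_less_Suc shift_less_Suc by blast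
qed

text \<open>Positions increase strictly, so at most one of the four belongs to the new minimum: one
  disjunct for each place it can take. By \<open>mono\<close>, comparing 1 with raised entries
  amounts to comparing 0 with the entries of \<open>p\<close>.\<close>

lemma occurs_ins:
  assumes s: "s \<le> length p" and mono: "\<And>a b c d. R (Suc a) (Suc b) (Suc c) (Suc d) = R a b c d"
  shows "occurs (ins s p) R \<longleftrightarrow> occurs p R
    \<or> (\<exists>i<length p. \<exists>j<length p. \<exists>k<length p. s \<le> i \<and> i < j \<and> j < k \<and> R 0 (p!i) (p!j) (p!k))
    \<or> (\<exists>i<length p. \<exists>j<length p. \<exists>k<length p. i < s \<and> s \<le> j \<and> j < k \<and> R (p!i) 0 (p!j) (p!k))
    \<or> (\<exists>i<length p. \<exists>j<length p. \<exists>k<length p. i < j \<and> j < s \<and> s \<le> k \<and> R (p!i) (p!j) 0 (p!k))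
    \<or> (\<exists>i<length p. \<exists>j<length p. \<exists>k<length p. i < j \<and> j < k \<and> k < s \<and> R (p!i) (p!j) (p!k) 0)"
proof -
  have *: "(\<exists>i<Suc (length p). P i) \<longleftrightarrow> P s \<or> (\<exists>i<length p. P (shift s i))" for P
    by (rule ex_ins_iff[OF s])
  show ?thesis
    unfolding occurs_def length_ins * using s
    by (simp add: ex_disj_distrib conj_disj_distribL conj_disj_distribR
          mono mono[where a=0, simplified] mono[where b=0, simplified]
          mono[where c=0, simplified] mono[where d=0, simplified] cong: conj_cong)
      (simp only: disj_ac)
qed

section \<open>Active sites\<close>

text \<open>
  Site \<open>s\<close> of \<open>p\<close> is the gap in front of the entry with index \<open>s\<close>. Here \<open>asc p a b\<close> speaks about
  the entries between the sites \<open>a\<close> and \<open>b\<close>, and the three ways in which a site is blocked correspond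
  to the patterns 1243, 2341 and 3412, whose entry 1 would be played by the new minimum.
\<close>

definition asc :: "nat list \<Rightarrow> nat \<Rightarrow> nat \<Rightarrow> bool" where
  "asc p a b \<longleftrightarrow> (\<exists>i<length p. \<exists>j<length p. a \<le> i \<and> i < j \<and> j < b \<and> p ! i < p ! j)"

definition desc :: "nat list \<Rightarrow> nat \<Rightarrow> bool" where
  "desc p a \<longleftrightarrow> (\<exists>i<length p. \<exists>j<length p. a \<le> i \<and> i < j \<and> p ! j < p ! i)"

definition blocked1 :: "nat list \<Rightarrow> nat \<Rightarrow> bool" where
  "blocked1 p s \<longleftrightarrow> (\<exists>i<length p. \<exists>j<length p. \<exists>k<length p.
     s \<le> i \<and> i < j \<and> j < k \<and> p ! i < p ! k \<and> p ! k < p ! j)"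

definition blocked2 :: "nat list \<Rightarrow> nat \<Rightarrow> bool" where
  "blocked2 p s \<longleftrightarrow> (\<exists>i<length p. \<exists>j<length p. \<exists>k<length p.
     i < j \<and> j < k \<and> k < s \<and> p ! i < p ! j \<and> p ! j < p ! k)"

definition blocked3 :: "nat list \<Rightarrow> nat \<Rightarrow> bool" where
  "blocked3 p s \<longleftrightarrow> (\<exists>i<length p. \<exists>j<length p. \<exists>k<length p.
     i < j \<and> j < s \<and> s \<le> k \<and> p ! k < p ! i \<and> p ! i < p ! j)"

definition act :: "nat list \<Rightarrow> nat set" where
  "act p = {s. s \<le> length p \<and> \<not> blocked1 p s \<and> \<not> blocked2 p s \<and> \<not> blocked3 p s}"

lemma act_le: "s \<in> act p \<Longrightarrow> s \<le> length p"
  by (simp add: act_def)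

lemma finite_act [simp]: "finite (act p)"
  by (rule finite_subset[of _ "{..length p}"]) (auto dest: act_le)

text \<open>Below positive entries, the new minimum can only play the 1 of a pattern. The one
  disjunct of \<open>occurs_ins\<close> that survives is then the matching blocking
  condition.\<close>

lemma good_ins_iff:
  assumes "s \<le> length p" and pos: "0 \<notin> set p"
  shows "good (ins s p) \<longleftrightarrow> good p \<and> s \<in> act p"
proof -
  have *: "0 < p ! i" if "i < length p" for i
    using that pos by (metis gr0I nth_mem)
  then have "occurs (ins s p) (\<lambda>a b c d. a < b \<and> b < d \<and> d < c) \<longleftrightarrow>
      occurs p (\<lambda>a b c d. a < b \<and> b < d \<and> d < c) \<or> blocked1 p s"
    unfolding blocked1_def using assms(1) by (simp add: occurs_ins cong: conj_cong)
  moreover have "occurs (ins s p) (\<lambda>a b c d. d < a \<and> a < b \<and> b < c) \<longleftrightarrow>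
      occurs p (\<lambda>a b c d. d < a \<and> a < b \<and> b < c) \<or> blocked2 p s"
    unfolding blocked2_def using assms(1) * by (simp add: occurs_ins cong: conj_cong)
  moreover have "occurs (ins s p) (\<lambda>a b c d. c < d \<and> d < a \<and> a < b) \<longleftrightarrow>
      occurs p (\<lambda>a b c d. c < d \<and> d < a \<and> a < b) \<or> blocked3 p s"
    unfolding blocked3_def using assms(1) * by (simp add: occurs_ins cong: conj_cong)
  ultimately show ?thesis
    unfolding good_def act_def using assms(1) by blast
qed

lemma shift_le_less [simp]:
  "q \<le> s \<Longrightarrow> q \<le> shift s i \<longleftrightarrow> q \<le> i"
  "q \<le> s \<Longrightarrow> shift s i < q \<longleftrightarrow> i < q"
  "s \<le> t \<Longrightarrow> Suc t \<le> shift s i \<longleftrightarrow> t \<le> i"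
  "s \<le> t \<Longrightarrow> shift s i < Suc t \<longleftrightarrow> i < t"
  by (auto simp: shift_def)

lemmas split_disj_simps = ex_disj_distrib conj_disj_distribL conj_disj_distribR

text \<open>Sites in front of the new minimum keep their number, those behind it move up by one, and
  site \<open>s\<close> splits into \<open>s\<close> and \<open>Suc s\<close>. Any entry between
  \<open>q\<close> and \<open>s\<close> forms a descent with the minimum.\<close>

lemma desc_ins:
  assumes "s \<le> length p" and pos: "0 \<notin> set p"
  shows "q \<le> s \<Longrightarrow> desc (ins s p) q \<longleftrightarrow> q < s \<or> desc p s"
    and "s \<le> t \<Longrightarrow> desc (ins s p) (Suc t) \<longleftrightarrow> desc p t"
proof -
  have pos: "0 < p ! i" if "i < length p" for i
    using that pos by (metis gr0I nth_mem)
  show "desc (ins s p) q \<longleftrightarrow> q < s \<or> desc p s" if "q \<le> s"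
  proof (cases "q = s")
    case True
    then show ?thesis using assms(1) unfolding desc_def
      by (simp add: ex_ins_iff[OF assms(1)] split_disj_simps cong: conj_cong)
  next
    case False
    then have "q < s" using that by simp
    moreover have "\<exists>i<length p. q \<le> i \<and> i < s" using \<open>q < s\<close> assms(1) by (intro exI[of _ q]) auto
    ultimately show ?thesis using assms(1) pos unfolding desc_def
      by (simp add: ex_ins_iff[OF assms(1)] split_disj_simps cong: conj_cong)
  qed
  show "desc (ins s p) (Suc t) \<longleftrightarrow> desc p t" if "s \<le> t"
    using assms(1) that unfolding desc_def
    by (simp add: ex_ins_iff[OF assms(1)] split_disj_simps cong: conj_cong)
qed

text \<open>The minimum ends no ascent and starts one with every later entry, so a window around it
  has an ascent once it includes an old entry behind it.\<close>

lemma asc_ins: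
  assumes "s \<le> length p" and pos: "0 \<notin> set p"
  shows "b \<le> s \<Longrightarrow> asc (ins s p) a b \<longleftrightarrow> asc p a b"
    and "s \<le> c \<Longrightarrow> asc (ins s p) (Suc c) (Suc d) \<longleftrightarrow> asc p c d"
    and "a \<le> s \<Longrightarrow> s \<le> d \<Longrightarrow> d \<le> length p \<Longrightarrow> asc (ins s p) a (Suc d) \<longleftrightarrow> s < d \<or> asc p a d"
proof -
  have pos: "0 < p ! i" if "i < length p" for i
    using that pos by (metis gr0I nth_mem)
  show "asc (ins s p) a b \<longleftrightarrow> asc p a b" if "b \<le> s"
    using assms(1) that unfolding asc_def
    by (simp add: ex_ins_iff[OF assms(1)] split_disj_simps cong: conj_cong) (auto simp: shift_def)
  show "asc (ins s p) (Suc c) (Suc d) \<longleftrightarrow> asc p c d" if "s \<le> c"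
  proof (cases "s \<le> d")
    case True
    then show ?thesis using assms(1) that unfolding asc_def
      by (simp add: ex_ins_iff[OF assms(1)] split_disj_simps cong: conj_cong)
  qed (use that in \<open>auto simp: asc_def\<close>)
  show "asc (ins s p) a (Suc d) \<longleftrightarrow> s < d \<or> asc p a d" if "a \<le> s" "s \<le> d" "d \<le> length p"
  proof -
    have "(\<exists>j<length p. s \<le> j \<and> j < d) \<longleftrightarrow> s < d"
      using that by (auto intro!: exI[of _ s])
    then show ?thesis
      using assms(1) that pos unfolding asc_def
      by (simp add: ex_ins_iff[OF assms(1)] split_disj_simps cong: conj_cong)
  qed
qed

text \<open>When a still smaller minimum comes next, the entry just inserted can only play the 2.
  For a site to its left it completes 1243 with a later descent as 43, and 3412 with an ascent
  before the site as 34. For a site to its right it completes 2341 with an ascent in between as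
  34.\<close>

lemma act_ins:
  assumes "s \<le> length p" and pos: "0 \<notin> set p"
  shows "act (ins s p) = {q \<in> act p. q \<le> s \<and> \<not> asc p 0 q \<and> \<not> desc p s}
                       \<union> Suc ` {t \<in> act p. s \<le> t \<and> \<not> asc p s t}"
proof -
  have pos: "0 < p ! i" if "i < length p" for i
    using that pos by (metis gr0I nth_mem)
  have left: "blocked1 (ins s p) q \<longleftrightarrow> blocked1 p q \<or> desc p s"
          "blocked2 (ins s p) q \<longleftrightarrow> blocked2 p q"
          "blocked3 (ins s p) q \<longleftrightarrow> blocked3 p q \<or> asc p 0 q" if "q \<le> s" for q
    using assms(1) that pos unfolding blocked1_def blocked2_def blocked3_def desc_def asc_def
    by (simp_all add: ex_ins_iff[OF assms(1)] split_disj_simps cong: conj_cong) (simp_all only: disj_commute)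
  have right: "blocked1 (ins s p) (Suc t) \<longleftrightarrow> blocked1 p t"
          "blocked2 (ins s p) (Suc t) \<longleftrightarrow> blocked2 p t \<or> asc p s t"
          "blocked3 (ins s p) (Suc t) \<longleftrightarrow> blocked3 p t" if "s \<le> t" for t
    using assms(1) that pos unfolding blocked1_def blocked2_def blocked3_def desc_def asc_def
    by (simp_all add: ex_ins_iff[OF assms(1)] split_disj_simps cong: conj_cong) (simp_all only: disj_commute)
  show ?thesis
  proof (rule set_eqI)
    fix x
    consider "x \<le> s" | t where "x = Suc t" "s \<le> t" by (cases x) fastforce+
    then show "x \<in> act (ins s p) \<longleftrightarrow> x \<in> {q \<in> act p. q \<le> s \<and> \<not> asc p 0 q \<and> \<not> desc p s}
                       \<union> Suc ` {t \<in> act p. s \<le> t \<and> \<not> asc p s t}"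
    proof cases
      case 1
      then show ?thesis using assms(1) unfolding act_def by (auto simp: left)
    next
      case 2
      then show ?thesis using assms(1) unfolding act_def by (auto simp: right)
    qed
  qed
qed

section \<open>Counting avoiders by descendants\<close>

definition good_perms :: "nat \<Rightarrow> nat list set" where
  "good_perms n = {p \<in> permutations_of_set {1..n}. good p}"

lemma good_permsD:
  assumes "p \<in> good_perms n"
  shows "length p = n" "0 \<notin> set p" "good p"
  using assms by (auto simp: good_perms_def permutations_of_set_def distinct_card[symmetric])

lemma distinct_ins_iff:
  assumes "s \<le> length p"
  shows "distinct (ins s p) \<longleftrightarrow> distinct p \<and> 0 \<notin> set p"
proof -
  obtain xs ys where xy: "take s p = xs" "drop s p = ys" "p = xs @ ys"
    by (metis append_take_drop_id)
  show ?thesis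
    unfolding ins_def xy(1,2) unfolding xy(3) by (auto simp: distinct_map)
qed

lemma set_ins: "set (ins s p) = insert 1 (Suc ` set p)"
proof -
  have "set p = set (take s p) \<union> set (drop s p)"
    by (metis append_take_drop_id set_append)
  then show ?thesis by (auto simp: ins_def)
qed

lemma ins_perm:
  assumes "p \<in> permutations_of_set {1..n}" "s \<le> n"
  shows "ins s p \<in> permutations_of_set {1..Suc n}"
proof -
  from assms have p: "set p = {1..n}" "distinct p" "length p = n"
    by (auto simp: permutations_of_set_def distinct_card[symmetric])
  have "insert 1 (Suc ` {1..n}) = {1..Suc n}"
    by (auto simp: image_Suc_atLeastAtMost)
  then show ?thesis
    using p assms(2) by (auto simp: permutations_of_set_def distinct_ins_iff set_ins)
qed

lemma ins_inject:
  assumes "ins s p = ins t q" "s \<le> length p" "t \<le> length q" "0 \<notin> set p" "0 \<notin> set q"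
  shows "s = t \<and> p = q"
proof -
  have "1 \<notin> set (map Suc (take s p))" "1 \<notin> set (map Suc (take t q))"
       "1 \<notin> set (map Suc (drop s p))" "1 \<notin> set (map Suc (drop t q))"
    using assms(4,5) by (auto dest: in_set_takeD in_set_dropD)
  \<comment> \<open>The entry 1 occurs only once, so cutting at it yields equal parts.\<close>
  then have "map Suc (take s p) = map Suc (take t q)" "map Suc (drop s p) = map Suc (drop t q)"
    using assms(1) unfolding ins_def by (metis append_Cons_eq_iff)+
  then have *: "take s p = take t q" "drop s p = drop t q"
    by (auto simp: inj_map_eq_map)
  then have "length (take s p) = length (take t q)" by simp
  with assms(2,3) have "s = t" by simp
  with * show ?thesis by (metis append_take_drop_id)
qed

lemma ex_ins:
  assumes "r \<in> permutations_of_set {1..Suc n}"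
  obtains s p where "p \<in> permutations_of_set {1..n}" "s \<le> n" "r = ins s p"
proof -
  from assms have r: "set r = {1..Suc n}" "distinct r" by (auto simp: permutations_of_set_def)
  then have "1 \<in> set r" by simp
  then obtain xs ys where xy: "r = xs @ 1 # ys" by (metis split_list)
  have pos: "0 \<notin> set xs" "0 \<notin> set ys" using r(1) xy by auto
  define p where "p = map (\<lambda>x. x - 1) (xs @ ys)"
  have Suc_pred: "map (\<lambda>x. Suc (x - Suc 0)) zs = zs" if "0 \<notin> set zs" for zs
    using that by (induction zs) auto
  have ri: "r = ins (length xs) p"
    using pos unfolding ins_def p_def xy by (simp add: comp_def Suc_pred)
  have len: "length xs \<le> length p" by (simp add: p_def)
  have "distinct p" using r(2) ri distinct_ins_iff[OF len] by simp
  moreover have "set p = {1..n}"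
  proof -
    have 0: "0 \<notin> set p" using r(2) ri distinct_ins_iff[OF len] by simp
    have "insert 1 (Suc ` set p) = {1..Suc n}" using r(1) ri set_ins by simp
    then have "Suc x \<in> insert 1 (Suc ` set p) \<longleftrightarrow> Suc x \<in> {1..Suc n}" for x by simp
    then have *: "x = 0 \<or> x \<in> set p \<longleftrightarrow> x \<le> n" for x by (auto simp: inj_image_mem_iff)
    show ?thesis
    proof (rule set_eqI)
      fix x show "x \<in> set p \<longleftrightarrow> x \<in> {1..n}" using *[of x] 0 by (cases "x = 0") auto
    qed
  qed
  ultimately have perm: "p \<in> permutations_of_set {1..n}" by (simp add: permutations_of_set_def)
  then have "length p = n" by (auto simp: permutations_of_set_def distinct_card[symmetric])
  then show ?thesis using that[OF perm _ ri] len by simp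
qed

text \<open>Deleting the 1 gives the unique parent, and \<open>good_ins_iff\<close> shows that this
  parent is good and the site active.\<close>

lemma bij_betw_ins:
  "bij_betw (\<lambda>(p, s). ins s p) (SIGMA p:good_perms n. act p) (good_perms (Suc n))"
proof (rule bij_betwI')
  fix x y
  assume x: "x \<in> (SIGMA p:good_perms n. act p)" and y: "y \<in> (SIGMA p:good_perms n. act p)"
  have "x = y" if "(case x of (p, s) \<Rightarrow> ins s p) = (case y of (p, s) \<Rightarrow> ins s p)"
    using that x y by (auto dest!: ins_inject dest: act_le good_permsD split: prod.splits)
  then show "((case x of (p, s) \<Rightarrow> ins s p) = (case y of (p, s) \<Rightarrow> ins s p)) \<longleftrightarrow> x = y" by blast
next
  fix x assume "x \<in> (SIGMA p:good_perms n. act p)"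
  then obtain p s where x: "x = (p, s)" "p \<in> good_perms n" "s \<in> act p" by auto
  then have "s \<le> n" using act_le good_permsD by metis
  then show "(case x of (p, s) \<Rightarrow> ins s p) \<in> good_perms (Suc n)"
    using x ins_perm[of p n s] good_ins_iff[of s p] good_permsD[OF x(2)]
    by (simp add: good_perms_def)
next
  fix r assume r: "r \<in> good_perms (Suc n)"
  then obtain s p where *: "p \<in> permutations_of_set {1..n}" "s \<le> n" "r = ins s p"
    using ex_ins unfolding good_perms_def by blast
  have "length p = n" "0 \<notin> set p"
    using *(1) by (auto simp: permutations_of_set_def distinct_card[symmetric])
  then have "good p \<and> s \<in> act p"
    using * r good_ins_iff[of s p] by (simp add: good_perms_def)
  then show "\<exists>x\<in>SIGMA p:good_perms n. act p. r = (case x of (p, s) \<Rightarrow> ins s p)"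
    using * by (auto simp: good_perms_def)
qed

primrec cnt :: "nat \<Rightarrow> nat list \<Rightarrow> nat" where
  "cnt 0 p = 1"
| "cnt (Suc m) p = (\<Sum>s\<in>act p. cnt m (ins s p))"

text \<open>The level \<open>n\<close> is left free because each induction step moves one generation
  from \<open>cnt\<close> to level \<open>Suc n\<close>.\<close>

lemma card_good_perms: "card (good_perms (n + m)) = (\<Sum>p\<in>good_perms n. cnt m p)"
proof (induction m arbitrary: n)
  case (Suc m)
  have fin: "finite (good_perms n)" by (simp add: good_perms_def)
  have "(\<Sum>p\<in>good_perms n. cnt (Suc m) p) = (\<Sum>(p, s)\<in>(SIGMA p:good_perms n. act p). cnt m (ins s p))"
    using fin by (simp add: sum.Sigma)
  also have "\<dots> = (\<Sum>x\<in>(SIGMA p:good_perms n. act p). cnt m (case x of (p, s) \<Rightarrow> ins s p))"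
    by (simp add: case_prod_beta)
  also have "\<dots> = (\<Sum>r\<in>good_perms (Suc n). cnt m r)"
    by (rule sum.reindex_bij_betw[OF bij_betw_ins])
  finally show ?case using Suc.IH[of "Suc n"] by simp
qed simp

lemma good_perms_0: "good_perms 0 = {[]}"
  by (auto simp: good_perms_def good_def occurs_def permutations_of_set_def)

lemma card_avoiders: "card (avoiders {[1,2,4,3], [2,3,4,1], [3,4,1,2]} n) = cnt n []"
  using card_good_perms[of 0 n]
  by (simp add: avoiders_eq good_perms_def[symmetric] good_perms_0 del: One_nat_def)

section \<open>States of the generating tree\<close>

text \<open>Listed from the largest down, the elements of \<open>A\<close> have 0, 1, 2, ... larger
  ones. This turns a sum over sites into a sum over the indices of the child states.\<close>

lemma sum_card_greater:
  fixes A :: "'a :: linorder set"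
  assumes "finite A"
  shows "(\<Sum>s\<in>A. f (card {t \<in> A. s < t})) = (\<Sum>i<card A. f i)"
  using assms
proof (induction rule: finite_linorder_min_induct)
  case (insert b A)
  have "b \<notin> A" using insert.hyps by auto
  have "{t \<in> insert b A. s < t} = {t \<in> A. s < t}" if "s \<in> A" for s
    using insert.hyps that by auto
  moreover have "{t \<in> insert b A. b < t} = A" using insert.hyps by auto
  ultimately show ?case
    using insert.IH insert.hyps(1) \<open>b \<notin> A\<close> by (simp add: add.commute)
qed simp

lemma asc_antimono: "asc p a b \<Longrightarrow> a' \<le> a \<Longrightarrow> asc p a' b"
  unfolding asc_def by (meson le_trans)

lemma not_asc_refl: "\<not> asc p a a"
  by (auto simp: asc_def)

lemma zero_notin_ins [simp]: "0 \<notin> set (ins s p)"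
  by (simp add: set_ins)

text \<open>
  In the states below, \<open>L\<close> collects the active sites whose number is the index of the state;
  for state P the index is the number of all active sites. States Z and A' have as many
  descendants as P with index 2 and A with index 1.
\<close>

definition stateP :: "nat list \<Rightarrow> bool" where
  "stateP p \<longleftrightarrow> 0 \<notin> set p \<and>
     (\<forall>s\<in>act p. \<forall>t\<in>act p. (s \<le> t \<longrightarrow> \<not> asc p s t) \<and> (t \<le> s \<longrightarrow> asc p 0 t \<or> desc p s))"

definition stateZ :: "nat \<Rightarrow> nat \<Rightarrow> nat list \<Rightarrow> bool" where
  "stateZ x y p \<longleftrightarrow> 0 \<notin> set p \<and> act p = {x, y} \<and> x < y \<and>
     desc p x \<and> \<not> desc p y \<and> \<not> asc p 0 x \<and> asc p 0 y \<and> asc p x y"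

definition stateA :: "nat set \<Rightarrow> nat \<Rightarrow> nat \<Rightarrow> nat list \<Rightarrow> bool" where
  "stateA L q y p \<longleftrightarrow> 0 \<notin> set p \<and> finite L \<and> act p = insert q (insert y L) \<and>
     (\<forall>l\<in>L. l < q) \<and> q < y \<and> (\<forall>x\<in>insert q L. desc p x \<and> \<not> asc p 0 x) \<and>
     \<not> desc p y \<and> asc p 0 y \<and> (\<forall>l\<in>L. asc p l y) \<and> \<not> asc p q y"

definition stateA' :: "nat \<Rightarrow> nat \<Rightarrow> nat \<Rightarrow> nat list \<Rightarrow> bool" where
  "stateA' x y z p \<longleftrightarrow> 0 \<notin> set p \<and> act p = {x, y, z} \<and> x < y \<and> y < z \<and>
     desc p x \<and> \<not> desc p y \<and> \<not> desc p z \<and> \<not> asc p 0 x \<and> asc p 0 y \<and> asc p 0 z \<and>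
     \<not> asc p x y \<and> asc p x z \<and> \<not> asc p y z"

definition stateB :: "nat \<Rightarrow> nat set \<Rightarrow> nat \<Rightarrow> nat \<Rightarrow> nat list \<Rightarrow> bool" where
  "stateB x L q r p \<longleftrightarrow> 0 \<notin> set p \<and> finite L \<and>
     act p = insert x (insert q (insert r L)) \<and> x < q \<and> q < r \<and> (\<forall>l\<in>L. x < l \<and> l < q) \<and>
     desc p x \<and> \<not> asc p 0 x \<and> (\<forall>y\<in>insert q (insert r L). asc p 0 y \<and> \<not> asc p x y) \<and>
     (\<forall>l\<in>L. desc p l) \<and> \<not> desc p q \<and> \<not> desc p r"

definition stateC :: "nat set \<Rightarrow> nat \<Rightarrow> nat \<Rightarrow> nat \<Rightarrow> nat list \<Rightarrow> bool" where
  "stateC L q r z p \<longleftrightarrow> 0 \<notin> set p \<and> finite L \<and>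
     act p = insert q (insert r (insert z L)) \<and> q < r \<and> r < z \<and> (\<forall>l\<in>L. l < q) \<and>
     (\<forall>x\<in>insert q (insert r L). \<not> asc p 0 x) \<and> asc p 0 z \<and>
     (\<forall>l\<in>L. desc p l) \<and> \<not> desc p q \<and> \<not> desc p r \<and> \<not> desc p z \<and>
     (\<forall>x\<in>insert q L. asc p x z) \<and> \<not> asc p r z"

definition stateD :: "nat set \<Rightarrow> nat \<Rightarrow> nat \<Rightarrow> nat list \<Rightarrow> bool" where
  "stateD L q r p \<longleftrightarrow> 0 \<notin> set p \<and> finite L \<and>
     act p = insert q (insert r L) \<and> q < r \<and> (\<forall>l\<in>L. l < q) \<and>
     (\<forall>x\<in>insert q (insert r L). \<not> asc p 0 x) \<and>
     (\<forall>l\<in>L. desc p l) \<and> \<not> desc p q \<and> \<not> desc p r"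

section \<open>Succession rules of the states\<close>

lemma stateP_child:
  assumes "stateP p" "s \<in> act p"
  shows "stateP (ins s p)" "card (act (ins s p)) = Suc (card {t \<in> act p. s < t})"
proof -
  have p: "0 \<notin> set p" "s \<le> length p" using assms act_le by (auto simp: stateP_def)
  have len: "t \<le> length p" if "t \<in> act p" for t using that act_le by blast
  \<comment> \<open>Every site up to \<open>s\<close> is lost to an ascent before it or to a descent
    behind \<open>s\<close>; all sites from \<open>s\<close> on survive behind the minimum.\<close>
  have act: "act (ins s p) = Suc ` {t \<in> act p. s \<le> t}"
    using assms unfolding act_ins[OF p(2,1)] stateP_def by auto
  have "{t \<in> act p. s \<le> t} = insert s {t \<in> act p. s < t}" using assms(2) by auto
  then show "card (act (ins s p)) = Suc (card {t \<in> act p. s < t})"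
    unfolding act by (subst card_image) auto
  have "asc (ins s p) 0 (Suc t) \<or> desc (ins s p) (Suc u)"
    if "t \<in> act p" "u \<in> act p" "s \<le> t" "t \<le> u" for t u
    using assms that p len by (auto simp: stateP_def asc_ins desc_ins)
  moreover have "\<not> asc (ins s p) (Suc t) (Suc u)"
    if "t \<in> act p" "u \<in> act p" "s \<le> t" "t \<le> u" for t u
    using assms that p by (auto simp: stateP_def asc_ins)
  ultimately show "stateP (ins s p)"
    unfolding stateP_def act by auto
qed

lemma stateZ_child:
  assumes "stateZ x y p"
  shows "stateP (ins x p)" "act (ins x p) = {Suc x}" "stateZ x (Suc y) (ins y p)"
proof -
  note * = assms[unfolded stateZ_def]
  have len: "x \<le> length p" "y \<le> length p" using * act_le by auto
  show act: "act (ins x p) = {Suc x}"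
    using * not_asc_refl by (auto simp: act_ins[OF len(1)])
  then show "stateP (ins x p)"
    using * len by (simp add: stateP_def asc_ins desc_ins not_asc_refl)
  have "act (ins y p) = {x, Suc y}"
    using * not_asc_refl by (auto simp: act_ins[OF len(2)])
  then show "stateZ x (Suc y) (ins y p)"
    using * len unfolding stateZ_def by (auto simp: asc_ins desc_ins)
qed

text \<open>At \<open>l\<close> or \<open>q\<close> the descent to the right kills all sites on the
  left. An ascent kills \<open>y\<close> behind \<open>l\<close>, but not behind \<open>q\<close>.
  No descent follows \<open>y\<close>, so an insertion there keeps \<open>L\<close> and
  \<open>q\<close>.\<close>

lemma stateA_child:
  assumes "stateA L q y p"
  shows "l \<in> L \<Longrightarrow> stateP (ins l p)"
    and "l \<in> L \<Longrightarrow> card (act (ins l p)) = card {t \<in> L. l < t} + 2"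
    and "stateA {} (Suc q) (Suc y) (ins q p)"
    and "stateA L q (Suc y) (ins y p)"
proof -
  note * = assms[unfolded stateA_def]
  have p: "0 \<notin> set p" using * by blast
  have len: "t \<le> length p" if "t \<in> insert q (insert y L)" for t using * act_le that by blast
  have na: "\<not> asc p a x" if "x \<in> insert q L" for a x using * that asc_antimono by blast
  have lty: "l < y" if "l \<in> L" for l using * that by fastforce
  have act: "act (ins l p) = Suc ` (insert q (insert l {t \<in> L. l < t}))" if "l \<in> L" for l
    using * that lty na by (auto simp: act_ins[OF len p])
  show "card (act (ins l p)) = card {t \<in> L. l < t} + 2" if "l \<in> L"
    using * that unfolding act[OF that] by (subst card_image) (auto simp: card_insert_if)
  show "stateP (ins l p)" if l: "l \<in> L"
    using * l lty na len p unfolding stateP_def act[OF l] by (auto simp: asc_ins desc_ins)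
  have "act (ins q p) = {Suc q, Suc y}"
    using * na by (auto simp: act_ins[OF len p])
  then show "stateA {} (Suc q) (Suc y) (ins q p)"
    using * na len p unfolding stateA_def by (auto simp: asc_ins desc_ins)
  have "act (ins y p) = insert q (insert (Suc y) L)"
    using * lty na not_asc_refl by (auto simp: act_ins[OF len p])
  then show "stateA L q (Suc y) (ins y p)"
    using * lty na len p unfolding stateA_def by (auto simp: asc_ins desc_ins less_imp_le)
qed

lemma stateA'_child:
  assumes "stateA' x y z p"
  shows "stateA {} (Suc x) (Suc y) (ins x p)" "stateA' x (Suc y) (Suc z) (ins y p)"
    "stateZ x (Suc z) (ins z p)"
proof -
  note * = assms[unfolded stateA'_def]
  have p: "0 \<notin> set p" using * by blast
  have len: "t \<le> length p" if "t \<in> {x, y, z}" for t using * act_le that by blast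
  have "act (ins x p) = {Suc x, Suc y}"
    using * not_asc_refl by (auto simp: act_ins[OF len p])
  then show "stateA {} (Suc x) (Suc y) (ins x p)"
    using * len p unfolding stateA_def by (auto simp: asc_ins desc_ins)
  have "act (ins y p) = {x, Suc y, Suc z}"
    using * not_asc_refl by (auto simp: act_ins[OF len p])
  then show "stateA' x (Suc y) (Suc z) (ins y p)"
    using * len p unfolding stateA'_def by (auto simp: asc_ins desc_ins)
  have "act (ins z p) = {x, Suc z}"
    using * not_asc_refl by (auto simp: act_ins[OF len p])
  then show "stateZ x (Suc z) (ins z p)"
    using * len p unfolding stateZ_def by (auto simp: asc_ins desc_ins)
qed

text \<open>No window between two active sites contains an ascent, so nothing to the right is ever
  lost. To the left of an insertion at \<open>q\<close> or \<open>r\<close> only \<open>x\<close>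
  survives, since the other sites have an ascent before them.\<close>

lemma stateB_child:
  assumes "stateB x L q r p"
  shows "l \<in> L \<Longrightarrow> stateP (ins l p)"
    and "l \<in> L \<Longrightarrow> card (act (ins l p)) = card {t \<in> L. l < t} + 3"
    and "stateB (Suc x) (Suc ` L) (Suc q) (Suc r) (ins x p)"
    and "stateA' x (Suc q) (Suc r) (ins q p)"
    and "stateA {} x (Suc r) (ins r p)"
proof -
  note * = assms[unfolded stateB_def]
  have p: "0 \<notin> set p" using * by blast
  have len: "t \<le> length p" if "t \<in> insert x (insert q (insert r L))" for t
    using * act_le that by blast
  have na: "\<not> asc p a y" if "y \<in> insert q (insert r L)" "x \<le> a" for a y
    using * that asc_antimono by blast
  have ltr: "l < r" if "l \<in> L" for l using * that by fastforce
  have act: "act (ins l p) = Suc ` (insert q (insert r (insert l {t \<in> L. l < t})))" if "l \<in> L" for l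
    using * that ltr na by (auto simp: act_ins[OF len p])
  show "card (act (ins l p)) = card {t \<in> L. l < t} + 3" if "l \<in> L"
    using * ltr that unfolding act[OF that] by (subst card_image) (auto simp: card_insert_if)
  show "stateP (ins l p)" if l: "l \<in> L"
    using * ltr l na len p unfolding stateP_def act[OF l] by (auto simp: asc_ins desc_ins)
  have "act (ins x p) = insert (Suc x) (insert (Suc q) (insert (Suc r) (Suc ` L)))"
    using * not_asc_refl na ltr by (auto simp: act_ins[OF len p])
  then show "stateB (Suc x) (Suc ` L) (Suc q) (Suc r) (ins x p)"
    using * ltr na len p unfolding stateB_def by (auto simp: asc_ins desc_ins)
  have "act (ins q p) = {x, Suc q, Suc r}"
    using * na ltr not_asc_refl by (auto simp: act_ins[OF len p])
  then show "stateA' x (Suc q) (Suc r) (ins q p)"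
    using * na len p unfolding stateA'_def by (auto simp: asc_ins desc_ins)
  have "act (ins r p) = {x, Suc r}"
    using * na ltr not_asc_refl by (auto simp: act_ins[OF len p])
  then show "stateA {} x (Suc r) (ins r p)"
    using * na len p unfolding stateA_def by (auto simp: asc_ins desc_ins)
qed

text \<open>An insertion at \<open>q\<close> loses \<open>z\<close>, but it creates an ascent before
  \<open>Suc r\<close>, which takes over the role of \<open>z\<close>. An insertion at
  \<open>r\<close> or \<open>z\<close> puts a descent behind \<open>q\<close>, so \<open>q\<close>
  joins \<open>L\<close>.\<close>

lemma stateC_child:
  assumes "stateC L q r z p"
  shows "l \<in> L \<Longrightarrow> stateB (Suc l) (Suc ` {t \<in> L. l < t}) (Suc q) (Suc r) (ins l p)"
    and "stateC L q (Suc q) (Suc r) (ins q p)"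
    and "stateC (insert q L) r (Suc r) (Suc z) (ins r p)"
    and "stateA (insert q L) r (Suc z) (ins z p)"
proof -
  note * = assms[unfolded stateC_def]
  have p: "0 \<notin> set p" using * by blast
  have len: "t \<le> length p" if "t \<in> insert q (insert r (insert z L))" for t
    using * act_le that by blast
  have na: "\<not> asc p a y" if "y \<in> insert q (insert r L)" for a y
    using * that asc_antimono by blast
  have ltr: "l < r" "l < z" if "l \<in> L" for l using * that by fastforce+
  show "stateB (Suc l) (Suc ` {t \<in> L. l < t}) (Suc q) (Suc r) (ins l p)" if "l \<in> L"
  proof -
    have "act (ins l p) = insert (Suc l) (insert (Suc q) (insert (Suc r) (Suc ` {t \<in> L. l < t})))"
      using * that ltr na by (auto simp: act_ins[OF len p])
    then show ?thesis
      using * that ltr na len p unfolding stateB_def by (auto simp: asc_ins desc_ins)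
  qed
  have "act (ins q p) = insert q (insert (Suc q) (insert (Suc r) L))"
    using * not_asc_refl na ltr by (auto simp: act_ins[OF len p])
  then show "stateC L q (Suc q) (Suc r) (ins q p)"
    using * ltr na len p unfolding stateC_def by (auto simp: asc_ins desc_ins less_imp_le)
  have "act (ins r p) = insert r (insert (Suc r) (insert (Suc z) (insert q L)))"
    using * na ltr not_asc_refl by (auto simp: act_ins[OF len p])
  then show "stateC (insert q L) r (Suc r) (Suc z) (ins r p)"
    using * ltr na len p unfolding stateC_def by (auto simp: asc_ins desc_ins less_imp_le)
  have "act (ins z p) = insert r (insert (Suc z) (insert q L))"
    using * na ltr not_asc_refl by (auto simp: act_ins[OF len p])
  then show "stateA (insert q L) r (Suc z) (ins z p)"
    using * ltr na len p unfolding stateA_def by (auto simp: asc_ins desc_ins less_imp_le)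
qed

text \<open>In D no active site has an ascent before it. An insertion at \<open>q\<close> puts one
  before \<open>Suc r\<close>, which becomes the site \<open>z\<close> of C; an insertion at
  \<open>r\<close> puts none before an active site.\<close>

lemma stateD_child:
  assumes "stateD L q r p"
  shows "l \<in> L \<Longrightarrow> stateB (Suc l) (Suc ` {t \<in> L. l < t}) (Suc q) (Suc r) (ins l p)"
    and "stateC L q (Suc q) (Suc r) (ins q p)"
    and "stateD (insert q L) r (Suc r) (ins r p)"
proof -
  note * = assms[unfolded stateD_def]
  have p: "0 \<notin> set p" using * by blast
  have len: "t \<le> length p" if "t \<in> insert q (insert r L)" for t
    using * act_le that by blast
  have na: "\<not> asc p a y" if "y \<in> insert q (insert r L)" for a y
    using * that asc_antimono by blast
  have ltr: "l < r" if "l \<in> L" for l using * that by fastforce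
  show "stateB (Suc l) (Suc ` {t \<in> L. l < t}) (Suc q) (Suc r) (ins l p)" if "l \<in> L"
  proof -
    have "act (ins l p) = insert (Suc l) (insert (Suc q) (insert (Suc r) (Suc ` {t \<in> L. l < t})))"
      using * that ltr na by (auto simp: act_ins[OF len p])
    then show ?thesis
      using * that ltr na len p unfolding stateB_def by (auto simp: asc_ins desc_ins)
  qed
  have "act (ins q p) = insert q (insert (Suc q) (insert (Suc r) L))"
    using * na ltr by (auto simp: act_ins[OF len p])
  then show "stateC L q (Suc q) (Suc r) (ins q p)"
    using * ltr na len p unfolding stateC_def by (auto simp: asc_ins desc_ins less_imp_le)
  have "act (ins r p) = insert r (insert (Suc r) (insert q L))"
    using * na ltr by (auto simp: act_ins[OF len p])
  then show "stateD (insert q L) r (Suc r) (ins r p)"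
    using * ltr na len p unfolding stateD_def by (auto simp: asc_ins desc_ins less_imp_le)
qed

lemma act_Nil: "act [] = {0}"
  by (auto simp: act_def blocked1_def blocked2_def blocked3_def)

text \<open>The states start at length 1: the empty permutation has a single active site and fits
  none of them, whence the form \<open>1 + X * gfD 0\<close> of the final series.\<close>

lemma stateD_root: "stateD {} 0 1 (ins 0 [])"
proof -
  have "act (ins 0 []) = {0, Suc 0}"
    by (auto simp: act_ins act_Nil asc_def desc_def)
  moreover have "\<not> asc (ins 0 []) a b" "\<not> desc (ins 0 []) a" for a b
    by (auto simp: asc_def desc_def)
  ultimately show ?thesis
    by (simp add: stateD_def)
qed

section \<open>Generating functions\<close>

abbreviation X :: "rat fps" where "X \<equiv> fps_X"

definition gfy :: "rat fps" where "gfy = inverse (1 - X)"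
definition gfz :: "rat fps" where "gfz = inverse (1 - 2 * X)"
definition gfw :: "rat fps" where "gfw = inverse (1 - 3 * X + X^2)"

lemma gfy: "gfy * (1 - X) = 1" unfolding gfy_def by (rule inverse_mult_eq_1) simp
lemma gfz: "gfz * (1 - 2 * X) = 1" unfolding gfz_def by (rule inverse_mult_eq_1) simp
lemma gfw: "gfw * (1 - 3 * X + X^2) = 1" unfolding gfw_def by (rule inverse_mult_eq_1) simp

text \<open>At \<open>j = 0\<close> this is \<open>gfz\<close>, since A_0 has two children of its
  own type. The series of P_k is simply \<open>gfy ^ k\<close>.\<close>

definition gfA :: "nat \<Rightarrow> rat fps" where
  "gfA j = gfy ^ (j + 2) + gfz - gfy^2"

text \<open>
  For fixed generating functions of the other states, the rules for C and D are linear recurrences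
  in \<open>j\<close>. The constants below are the coefficients of their solutions in the basis
  \<open>gfy ^ j\<close>, \<open>1\<close>, \<open>j\<close>; they are written in partial fractions, except that
  \<open>X * gfz ^ 3 + X * gfz ^ 2\<close> serves to avoid halves.
\<close>

definition cB :: "rat fps" where
  "cB = 2 * gfz - gfy + gfy^2 - 3 * gfy^3 + gfy^4"

definition gfB :: "nat \<Rightarrow> rat fps" where
  "gfB j = gfy ^ (j + 3) + cB"

definition lC :: "rat fps" where
  "lC = gfz^2 - 4 * gfz + 2 * gfy + 2 * gfy^3 - gfy^4"

definition cC :: "rat fps" where
  "cC = X * gfz^3 + X * gfz^2 - 2 * gfz^2 - gfz + gfy + 2 * gfy^2 - gfy^3 + gfy^4"

definition gfC :: "nat \<Rightarrow> rat fps" where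
  "gfC j = (1 - X) * gfw * gfy ^ (j + 3) + cC + of_nat j * lC"

definition cD :: "rat fps" where
  "cD = X * gfz^3 + X * gfz^2 - 2 * gfz^2 - 2 * gfz + 2 * gfy + gfy^2 + gfy^4"

definition gfD :: "nat \<Rightarrow> rat fps" where
  "gfD j = gfz * (1 - X) * (1 + X * gfw) * gfy ^ (j + 2) + cD + of_nat j * lC"

section \<open>The series satisfy the succession rules\<close>

lemma geometric: "X * (\<Sum>i<k. gfy ^ (i + Suc n)) = gfy ^ n * (gfy ^ k - 1)"
proof (induction k)
  case (Suc k)
  \<comment> \<open>This makes the sum telescope.\<close>
  have "X * gfy = gfy - 1" using gfy by (simp add: algebra_simps)
  moreover have "X * gfy ^ (k + Suc n) = (X * gfy) * (gfy ^ n * gfy ^ k)"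
    by (simp add: power_add mult_ac)
  moreover have "gfy ^ n * (gfy ^ Suc k - 1) = gfy ^ n * (gfy ^ k - 1) + (gfy - 1) * (gfy ^ n * gfy ^ k)"
    by (simp add: algebra_simps)
  ultimately show ?case using Suc by (simp add: distrib_left)
qed simp

lemma gfP_rec: "gfy ^ k = 1 + X * (\<Sum>i<k. gfy ^ Suc i)"
  using geometric[where n=0] by simp

lemma gfA_rec: "gfA j = 1 + X * ((\<Sum>i<j. gfy ^ (i + 2)) + gfA 0 + gfA j)"
proof -
  have "X * (\<Sum>i<j. gfy ^ (i + 2)) = gfy * (gfy ^ j - 1)"
    using geometric[where n=1 and k=j] by simp
  \<comment> \<open>Naming the power leaves a polynomial identity in which \<open>j\<close> no
    longer appears as an exponent.\<close>
  moreover define Y where "Y = gfy ^ j"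
  ultimately show ?thesis
    using gfy gfz unfolding gfA_def power_add distrib_left Y_def[symmetric] power_0 mult_1_left by algebra
qed

lemma gfB_rec: "gfB j = 1 + X * ((\<Sum>i<j. gfy ^ (i + 3)) + gfB j + gfA 1 + gfA 0)"
proof -
  have "X * (\<Sum>i<j. gfy ^ (i + 3)) = gfy^2 * (gfy ^ j - 1)"
    using geometric[where n=2 and k=j] by simp
  moreover define Y where "Y = gfy ^ j"
  moreover have "cB * (1 - X) = 1 - gfy^2 + X * (gfA 1 + gfA 0)"
  proof -
    have "gfA 1 = gfy^3 + gfz - gfy^2" "gfA 0 = gfz"
      unfolding gfA_def by (simp_all add: numeral_3_eq_3 numeral_2_eq_2)
    then show ?thesis
      unfolding cB_def using gfy gfz by algebra
  qed
  ultimately show ?thesis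
    using gfy unfolding gfB_def power_add distrib_left Y_def[symmetric] by algebra
qed

lemma sum_gfB: "X * (\<Sum>i<j. gfB i) = gfy^2 * (gfy ^ j - 1) + of_nat j * X * cB"
  using geometric[where n=2 and k=j] by (simp add: gfB_def sum.distrib algebra_simps)

text \<open>Coefficients of \<open>j\<close> in the rules for C and D. In D the child C_j
  contributes another \<open>X * lC\<close>, which is why one \<open>lC\<close> serves both
  states.\<close>

lemma lC: "lC * (1 - 2 * X) = X * cB" "lC * (1 - X) = X * (cB + lC)"
  unfolding lC_def cB_def using gfy gfz by algebra+

text \<open>Terms free of \<open>j\<close> in the rule for C; \<open>X * lC\<close> comes from
  passing to \<open>Suc j\<close>.\<close>

lemma cC: "cC * (1 - 2 * X) = 1 - gfy^2 + X * (gfz - gfy^2) + X * lC"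
  unfolding cC_def lC_def using gfy gfz by algebra

lemma cD: "cD * (1 - X) = 1 - gfy^2 + X * cC + X * lC"
  unfolding cD_def cC_def lC_def using gfy gfz by algebra

lemma gfC_rec: "gfC j = 1 + X * ((\<Sum>i<j. gfB i) + gfC j + gfC (Suc j) + gfA (Suc j))"
proof -
  define Y where "Y = gfy ^ j"
  define J :: "rat fps" where "J = of_nat j"
  \<comment> \<open>Coefficient of \<open>gfy ^ (j + 3)\<close>: C_j and C_(j+1) contribute 1 and
    \<open>gfy\<close>. The denominator of \<open>gfw\<close> arises here as (1-X)^2 - X.\<close>
  have "(1 - X) * gfw * (1 - X - X * gfy) = 1"
    using gfy gfw by algebra
  then show ?thesis
    using gfy lC(1) cC sum_gfB[of j]
    unfolding gfC_def gfA_def add_Suc power_Suc power_add distrib_left Y_def[symmetric]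
      of_nat_Suc J_def[symmetric] by algebra
qed

lemma gfD_rec: "gfD j = 1 + X * ((\<Sum>i<j. gfB i) + gfC j + gfD (Suc j))"
proof -
  define Y where "Y = gfy ^ j"
  define J :: "rat fps" where "J = of_nat j"
  \<comment> \<open>Coefficient of \<open>gfy ^ (j + 2)\<close>: D_(j+1) contributes
    \<open>X * gfy\<close> on the left; on the right, 1 comes from the B states and
    \<open>X * gfw\<close> from C_j.\<close>
  have "gfz * (1 - X) * (1 + X * gfw) * (1 - X * gfy) = 1 + X * gfw"
    using gfy gfz by algebra
  then show ?thesis
    using gfy lC(2) cD sum_gfB[of j]
    unfolding gfC_def gfD_def add_Suc power_Suc power_add distrib_left Y_def[symmetric]
      of_nat_Suc J_def[symmetric] by algebra
qed

lemma gfD_0: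
  "1 + X * gfD 0 = gfw + gfy + (1 - X + X^2) * gfy^4 - 2 * (1 - X) * (1 - 2 * X - X^2) * gfz^3"
proof -
  \<comment> \<open>The only part containing \<open>gfw\<close> is split off; its
    \<open>- gfz\<close> is absorbed by the next identity.\<close>
  have "X * (gfz * (1 - X) * (1 + X * gfw) * gfy^2) = gfw - gfz"
    using gfy gfz gfw by algebra
  moreover have "1 - gfz + X * cD = gfy + (1 - X + X^2) * gfy^4 - 2 * (1 - X) * (1 - 2 * X - X^2) * gfz^3"
    unfolding cD_def using gfy gfz by algebra
  moreover have "gfD 0 = gfz * (1 - X) * (1 + X * gfw) * gfy^2 + cD"
    by (simp add: gfD_def power2_eq_square)
  ultimately show ?thesis
    by algebra
qed

section \<open>Descendant counts as coefficients\<close>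

lemma fps_nth_rec:
  assumes "(F :: rat fps) = 1 + X * G"
  shows "fps_nth F 0 = 1" "fps_nth F (Suc m) = fps_nth G m"
  by (subst assms, simp)+

text \<open>The scheme for all states: the constant term counts \<open>p\<close> itself, and degree
  \<open>Suc m\<close> is read off the children in degree \<open>m\<close>. Induction on
  \<open>m\<close> thus works even for C and D, whose index grows.\<close>

lemma cnt_P: "stateP p \<Longrightarrow> of_nat (cnt m p) = fps_nth (gfy ^ card (act p)) m"
proof (induction m arbitrary: p)
  case 0
  then show ?case using fps_nth_rec(1)[OF gfP_rec] by simp
next
  case (Suc m)
  have "of_nat (cnt (Suc m) p) = (\<Sum>s\<in>act p. fps_nth (gfy ^ Suc (card {t \<in> act p. s < t})) m)"
    using Suc stateP_child by simp
  also have "\<dots> = (\<Sum>i<card (act p). fps_nth (gfy ^ Suc i) m)"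
    by (rule sum_card_greater) simp
  also have "\<dots> = fps_nth (gfy ^ card (act p)) (Suc m)"
    by (simp add: fps_nth_rec(2)[OF gfP_rec] fps_sum_nth)
  finally show ?case .
qed

lemma cnt_Z: "stateZ x y p \<Longrightarrow> of_nat (cnt m p) = fps_nth (gfy ^ 2) m"
proof (induction m arbitrary: y p)
  case 0
  then show ?case using fps_nth_rec(1)[OF gfP_rec] by simp
next
  case (Suc m)
  have "act p = {x, y}" "x < y" using Suc.prems by (auto simp: stateZ_def)
  then have "of_nat (cnt (Suc m) p) = fps_nth gfy m + fps_nth (gfy^2) m"
    using Suc.IH[OF stateZ_child(3)[OF Suc.prems]] cnt_P[OF stateZ_child(1)[OF Suc.prems], of m]
      stateZ_child(2)[OF Suc.prems] by simp
  moreover have "gfy^2 = 1 + X * (gfy + gfy^2)"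
    using gfP_rec[of 2] by (simp add: numeral_2_eq_2)
  ultimately show ?case
    using fps_nth_rec(2)[of "gfy^2" "gfy + gfy^2" m] by simp
qed

lemma cnt_A: "stateA L q y p \<Longrightarrow> of_nat (cnt m p) = fps_nth (gfA (card L)) m"
proof (induction m arbitrary: L q y p)
  case 0
  then show ?case using fps_nth_rec(1)[OF gfA_rec] by simp
next
  case (Suc m)
  note child = stateA_child[OF Suc.prems]
  have L: "finite L" "act p = insert q (insert y L)" "q \<notin> insert y L" "y \<notin> L"
    using Suc.prems by (auto simp: stateA_def)
  have "of_nat (cnt (Suc m) p) = (\<Sum>s\<in>L. fps_nth (gfy ^ (card {t \<in> L. s < t} + 2)) m)
      + fps_nth (gfA 0) m + fps_nth (gfA (card L)) m"
    using Suc.IH[OF child(3)] Suc.IH[OF child(4)] cnt_P[OF child(1)] child(2) L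
    by simp
  also have "(\<Sum>s\<in>L. fps_nth (gfy ^ (card {t \<in> L. s < t} + 2)) m) =
      (\<Sum>i<card L. fps_nth (gfy ^ (i + 2)) m)"
    using L(1) by (rule sum_card_greater)
  finally show ?case
    by (simp add: fps_nth_rec(2)[OF gfA_rec] fps_sum_nth)
qed

text \<open>The rule of A' is that of A_1 with Z in place of P_2, and \<open>cnt_Z\<close> equates
  these two.\<close>

lemma cnt_A': "stateA' x y z p \<Longrightarrow> of_nat (cnt m p) = fps_nth (gfA 1) m"
proof (induction m arbitrary: y z p)
  case 0
  then show ?case using fps_nth_rec(1)[OF gfA_rec] by simp
next
  case (Suc m)
  note child = stateA'_child[OF Suc.prems]
  have "act p = {x, y, z}" "x < y" "y < z" using Suc.prems by (auto simp: stateA'_def)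
  then have "of_nat (cnt (Suc m) p) = fps_nth (gfA 0) m + fps_nth (gfA 1) m + fps_nth (gfy^2) m"
    using cnt_A[OF child(1), of m] Suc.IH[OF child(2)] cnt_Z[OF child(3), of m] by simp
  moreover have "gfA 1 = 1 + X * (gfy^2 + gfA 0 + gfA 1)"
    using gfA_rec[of 1] by (simp add: power2_eq_square)
  ultimately show ?case
    using fps_nth_rec(2)[of "gfA 1" "gfy^2 + gfA 0 + gfA 1" m] by simp
qed

lemma cnt_B: "stateB x L q r p \<Longrightarrow> of_nat (cnt m p) = fps_nth (gfB (card L)) m"
proof (induction m arbitrary: x L q r p)
  case 0
  then show ?case using fps_nth_rec(1)[OF gfB_rec] by simp
next
  case (Suc m)
  note child = stateB_child[OF Suc.prems]
  have L: "finite L" "act p = insert x (insert q (insert r L))" "x \<notin> insert q (insert r L)"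
    "q \<notin> insert r L" "r \<notin> L"
    using Suc.prems by (auto simp: stateB_def)
  have "of_nat (cnt (Suc m) p) = (\<Sum>s\<in>L. fps_nth (gfy ^ (card {t \<in> L. s < t} + 3)) m)
      + fps_nth (gfB (card L)) m + fps_nth (gfA 1) m + fps_nth (gfA 0) m"
    using Suc.IH[OF child(3)] cnt_A'[OF child(4), of m] cnt_A[OF child(5), of m]
      cnt_P[OF child(1)] child(2) L
    by (simp add: card_image)
  also have "(\<Sum>s\<in>L. fps_nth (gfy ^ (card {t \<in> L. s < t} + 3)) m) =
      (\<Sum>i<card L. fps_nth (gfy ^ (i + 3)) m)"
    using L(1) by (rule sum_card_greater)
  finally show ?case
    by (simp add: fps_nth_rec(2)[OF gfB_rec] fps_sum_nth)
qed

lemma cnt_C: "stateC L q r z p \<Longrightarrow> of_nat (cnt m p) = fps_nth (gfC (card L)) m"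
proof (induction m arbitrary: L q r z p)
  case 0
  then show ?case using fps_nth_rec(1)[OF gfC_rec] by simp
next
  case (Suc m)
  note child = stateC_child[OF Suc.prems]
  have L: "finite L" "act p = insert q (insert r (insert z L))" "q \<notin> insert r (insert z L)"
    "r \<notin> insert z L" "z \<notin> L" "q \<notin> L"
    using Suc.prems by (auto simp: stateC_def)
  have "of_nat (cnt (Suc m) p) = (\<Sum>s\<in>L. fps_nth (gfB (card {t \<in> L. s < t})) m)
      + fps_nth (gfC (card L)) m + fps_nth (gfC (Suc (card L))) m + fps_nth (gfA (Suc (card L))) m"
    using Suc.IH[OF child(2)] Suc.IH[OF child(3)] cnt_A[OF child(4), of m] cnt_B[OF child(1)] L
    by (simp add: card_image)
  also have "(\<Sum>s\<in>L. fps_nth (gfB (card {t \<in> L. s < t})) m) = (\<Sum>i<card L. fps_nth (gfB i) m)"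
    using L(1) by (rule sum_card_greater)
  finally show ?case
    by (simp add: fps_nth_rec(2)[OF gfC_rec] fps_sum_nth)
qed

lemma cnt_D: "stateD L q r p \<Longrightarrow> of_nat (cnt m p) = fps_nth (gfD (card L)) m"
proof (induction m arbitrary: L q r p)
  case 0
  then show ?case using fps_nth_rec(1)[OF gfD_rec] by simp
next
  case (Suc m)
  note child = stateD_child[OF Suc.prems]
  have L: "finite L" "act p = insert q (insert r L)" "q \<notin> insert r L" "r \<notin> L" "q \<notin> L"
    using Suc.prems by (auto simp: stateD_def)
  have "of_nat (cnt (Suc m) p) = (\<Sum>s\<in>L. fps_nth (gfB (card {t \<in> L. s < t})) m)
      + fps_nth (gfC (card L)) m + fps_nth (gfD (Suc (card L))) m"
    using Suc.IH[OF child(3)] cnt_C[OF child(2), of m] cnt_B[OF child(1)] L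
    by (simp add: card_image)
  also have "(\<Sum>s\<in>L. fps_nth (gfB (card {t \<in> L. s < t})) m) = (\<Sum>i<card L. fps_nth (gfB i) m)"
    using L(1) by (rule sum_card_greater)
  finally show ?case
    by (simp add: fps_nth_rec(2)[OF gfD_rec] fps_sum_nth)
qed

lemma avoiders_fps_eq: "avoiders_fps {[1,2,4,3], [2,3,4,1], [3,4,1,2]} = 1 + X * gfD 0"
proof (rule fps_ext)
  fix n
  show "fps_nth (avoiders_fps {[1,2,4,3], [2,3,4,1], [3,4,1,2]}) n = fps_nth (1 + X * gfD 0) n"
    \<comment> \<open>For \<open>n > 0\<close>, length \<open>n\<close> is reached from length 1 by
      \<open>n - 1\<close> insertions; \<open>n = 0\<close> is the constant term.\<close>
    using cnt_D[OF stateD_root, of "n - 1"]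
    unfolding avoiders_fps_def fps_nth_Abs_fps card_avoiders
    by (cases n) (simp_all add: act_Nil)
qed

theorem theorem3p9:
  fixes T :: "nat list set" and x :: "rat fps"
  defines "T \<equiv> {[1,2,4,3], [2,3,4,1], [3,4,1,2]}"
    and "x \<equiv> fps_X"
  shows "avoiders_fps T =
           1 / (1 - 3 * x + x^2) + 1 / (1 - x) + (1 - x + x^2) / (1 - x)^4
           - 2 * (1 - x) * (1 - 2 * x - x^2) / (1 - 2 * x)^3"
proof -
  \<comment> \<open>Nonzero constant terms make the denominators units, so division becomes
    multiplication by an inverse.\<close>
  have "fps_nth ((1 - x) ^ k) 0 \<noteq> 0" "fps_nth ((1 - 2 * x) ^ k) 0 \<noteq> 0"
    "fps_nth (1 - 3 * x + x^2) 0 \<noteq> 0" for k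
    by (simp_all add: x_def fps_power_zeroth)
  then show ?thesis
    unfolding T_def avoiders_fps_eq gfD_0
    by (simp add: x_def fps_divide_unit gfy_def gfz_def gfw_def fps_inverse_power)
qed

end
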